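(* If $G_1$ and $G_2$ are finite simple graphs, then $$\nabla(G_1 \,\square\, G_2) \geq \alpha'(G_1)\, \alpha'(G_2).$$ Moreover, if $T$ is a finite tree, then $\nabla(T \,\square\, P_2) = \alpha'(T)$.
   Context: $P_n$ denotes the path on $n$ vertices (so $P_2=K_2$). A matching of a graph $G$ is a subset of its edges such that no two edges from it share a common vertex; the matching number $\alpha'(G)$ is the maximum size of a matching of $G$. A decycling set of a graph $G$ is a set $S\subseteq V(G)$ such that the subgraph of $G$ induced by $V(G)\setminus S$ is a forest (contains no cycle). The decycling number $\nabla(G)$ is the minimum cardinality of a decycling set of $G$. The Cartesian product $G \,\square\, H$ has vertex set $V(G)\times V(H)$, and two vertices $(g,h)$ and $(g',h')$ are adjacent if either $g=g'$ and $hh'\in E(H)$, or $gg'\in E(G)$ and $h=h'$. *)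

theory Defs
  imports "Graph_Theory.Digraph_Component"
begin

text \<open>
  Finite simple graphs are the models of the locale \<open>pair_graph\<close> of Graph_Theory: finite,
  symmetric, loop-free digraphs whose arcs are pairs of vertices.  An undirected edge
  corresponds to two opposite arcs and is represented by its set of end points.
\<close>

definition uedges :: "'a pair_pre_digraph \<Rightarrow> 'a set set" where
  "uedges G = {{u, v} | u v. (u, v) \<in> parcs G}"

definition is_matching :: "'a pair_pre_digraph \<Rightarrow> 'a set set \<Rightarrow> bool" where
  "is_matching G M \<longleftrightarrow> M \<subseteq> uedges G \<and> (\<forall>e\<in>M. \<forall>f\<in>M. e \<noteq> f \<longrightarrow> e \<inter> f = {})"

definition matching_number :: "'a pair_pre_digraph \<Rightarrow> nat" where
  "matching_number G = Max {card M | M. is_matching G M}"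

text \<open>
  In a symmetric digraph the closed walk a, b, a is a directed cycle in the sense of
  \<open>pre_digraph.cycle\<close>, so the library predicates \<open>forest\<close> and \<open>tree\<close> fail for every graph
  with an edge.  The cycles of a simple graph are the directed cycles of length at least 3.
\<close>

definition ugraph_cycle :: "('a, 'b) pre_digraph \<Rightarrow> 'b awalk \<Rightarrow> bool" where
  "ugraph_cycle G p \<longleftrightarrow> pre_digraph.cycle G p \<and> 3 \<le> length p"

definition ugraph_forest :: "('a, 'b) pre_digraph \<Rightarrow> bool" where
  "ugraph_forest G \<longleftrightarrow> \<not> (\<exists>p. ugraph_cycle G p)"

definition ugraph_tree :: "('a, 'b) pre_digraph \<Rightarrow> bool" where
  "ugraph_tree G \<longleftrightarrow> Digraph_Component.connected G \<and> ugraph_forest G"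

definition decycling_set :: "'a pair_pre_digraph \<Rightarrow> 'a set \<Rightarrow> bool" where
  "decycling_set G S \<longleftrightarrow>
     S \<subseteq> pverts G \<and> ugraph_forest (induce_subgraph (with_proj G) (pverts G - S))"

definition decycling_number :: "'a pair_pre_digraph \<Rightarrow> nat" where
  "decycling_number G = Min {card S | S. decycling_set G S}"

definition cartesian_product ::
    "'a pair_pre_digraph \<Rightarrow> 'b pair_pre_digraph \<Rightarrow> ('a \<times> 'b) pair_pre_digraph" where
  "cartesian_product G H =
     \<lparr> pverts = pverts G \<times> pverts H,
       parcs = {((g, h), (g', h')) | g h g' h'.
         (g = g' \<and> g \<in> pverts G \<and> (h, h') \<in> parcs H) \<or>
         ((g, g') \<in> parcs G \<and> h = h' \<and> h \<in> pverts H)} \<rparr>"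

definition path_graph :: "nat \<Rightarrow> nat pair_pre_digraph" where
  "path_graph n =
     \<lparr> pverts = {..<n},
       parcs = {(i, j) | i j. i < n \<and> j < n \<and> (j = Suc i \<or> i = Suc j)} \<rparr>"

lemma pair_graph_cartesian_product:
  assumes "pair_graph G" and "pair_graph H"
  shows "pair_graph (cartesian_product G H)"
proof -
  interpret G: pair_graph G by fact
  interpret H: pair_graph H by fact
  let ?P = "cartesian_product G H"
  have sub: "parcs ?P \<subseteq> pverts ?P \<times> pverts ?P"
    by (auto simp: cartesian_product_def dest: G.in_arcsD1 G.in_arcsD2 H.in_arcsD1 H.in_arcsD2)
  have finv: "finite (pverts ?P)"
    by (simp add: cartesian_product_def)
  have fina: "finite (parcs ?P)"
    using finite_subset[OF sub] finv by simp
  have sG: "sym (parcs G)" and sH: "sym (parcs H)"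
    using G.pair_sym_arcs H.pair_sym_arcs by (simp_all add: symmetric_def)
  have sP: "symmetric (with_proj ?P)"
    using sG sH by (auto simp: symmetric_def cartesian_product_def sym_def)
  have loopfree: "fst e \<noteq> snd e" if "e \<in> parcs ?P" for e
    using that by (auto simp: cartesian_product_def dest: G.pair_no_loops H.pair_no_loops)
  show ?thesis
    by unfold_locales (use sub finv fina sP loopfree in auto)
qed

lemma pair_graph_path_graph: "pair_graph (path_graph n)"
proof -
  have "finite {(i, j) | i j. i < n \<and> j < n \<and> (j = Suc i \<or> i = Suc j)}"
    by (rule finite_subset[of _ "{..<n} \<times> {..<n}"]) auto
  then show ?thesis
    by unfold_locales (auto simp: path_graph_def symmetric_def sym_def)
qed

end

theory Submission
  imports Defs
begin

text \<open>
  For the lower bound, an edge \<open>e\<close> of \<open>G\<^sub>1\<close> and an edge \<open>f\<close> of \<open>G\<^sub>2\<close> span a 4-cycle of the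
  product, with vertex set \<open>e \<times> f\<close>. Letting \<open>e\<close> and \<open>f\<close> range over maximum matchings gives
  \<open>\<alpha>'(G\<^sub>1) \<alpha>'(G\<^sub>2)\<close> pairwise disjoint 4-cycles, and a decycling set needs a vertex in each of them
  (\<open>card_matchings_le_decycling_set\<close>).

  For a tree \<open>T\<close> and the factor \<open>P\<^sub>2\<close>, which has matching number 1, the lower bound is
  \<open>\<alpha>'(T)\<close>. It is attained because a forest has a matching \<open>M\<close> and a vertex cover \<open>C\<close> with
  \<open>|C| = |M|\<close> (\<open>forest_matching_vertex_cover\<close>, Koenig's theorem for forests, obtained by
  stripping off leaves). Deleting \<open>C\<close> from one of the two layers \<open>T \<times> {0}\<close> and \<open>T \<times> {1}\<close> destroys
  all cycles (\<open>vertex_cover_decycles_prism\<close>): the rest of the layer 0 is independent, so its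
  vertices have degree at most 1 and lie on no cycle, and the layer 1 is a copy of \<open>T\<close>.

  All arguments about cycles use lists of vertices over the adjacency relation; the translation from
  walks given as lists of arcs is \<open>ugraph_forest_iff\<close>.
\<close>

section \<open>Cycles as lists of vertices\<close>

definition vcycle :: "('a \<times> 'a) set \<Rightarrow> 'a list \<Rightarrow> bool" where
  "vcycle E xs \<longleftrightarrow> 3 \<le> length xs \<and> distinct xs \<and>
     successively (\<lambda>x y. (x, y) \<in> E) xs \<and> (last xs, hd xs) \<in> E"

lemma vcycle_mono:
  assumes "vcycle E xs" and "E \<subseteq> F"
  shows "vcycle F xs"
  using assms by (auto simp: vcycle_def intro: successively_mono)

lemma vcycle_append_commute:
  assumes "vcycle E (xs @ ys)"
  shows "vcycle E (ys @ xs)"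
proof (cases "xs = [] \<or> ys = []")
  case True
  with assms show ?thesis by auto
next
  case False
  with assms show ?thesis by (auto simp: vcycle_def successively_append_iff)
qed

text \<open>
  Rotating the cycle so that it starts at \<open>x\<close>, the two neighbours are the second and the last
  vertex; they differ since the cycle has at least three vertices.
\<close>

lemma vcycle_two_neighbours:
  assumes "vcycle E xs" and "sym E" and "x \<in> set xs"
  obtains y z where "y \<noteq> z" "(x, y) \<in> E" "(x, z) \<in> E"
proof -
  obtain as bs where xs: "xs = as @ x # bs"
    using split_list[OF \<open>x \<in> set xs\<close>] by blast
  define cs where "cs = bs @ as"
  have cyc: "vcycle E (x # cs)"
    using vcycle_append_commute[of E as "x # bs"] assms(1) by (simp add: xs cs_def)
  then obtain y ds where cs: "cs = y # ds" and "ds \<noteq> []"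
    by (cases cs) (auto simp: vcycle_def Suc_le_eq)
  have "last ds \<in> set ds" using \<open>ds \<noteq> []\<close> by simp
  moreover have "y \<notin> set ds" using cyc by (simp add: vcycle_def cs)
  ultimately have "y \<noteq> last ds" by auto
  moreover have "(x, y) \<in> E" using cyc by (simp add: vcycle_def cs)
  moreover have "(x, last ds) \<in> E"
    using cyc \<open>ds \<noteq> []\<close> \<open>sym E\<close> by (auto simp: vcycle_def cs dest: symD)
  ultimately show thesis by (rule that)
qed

lemma vcycle_map:
  assumes "vcycle E xs" and "inj_on f (set xs)"
    and "\<And>x y. x \<in> set xs \<Longrightarrow> y \<in> set xs \<Longrightarrow> (x, y) \<in> E \<Longrightarrow> (f x, f y) \<in> F"
  shows "vcycle F (map f xs)"
proof -
  have "xs \<noteq> []" using assms(1) by (auto simp: vcycle_def)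
  moreover have "successively (\<lambda>x y. (f x, f y) \<in> F) xs"
    using assms(1,3) by (auto simp: vcycle_def intro: successively_mono)
  ultimately show ?thesis
    using assms by (auto simp: vcycle_def distinct_map successively_map last_map hd_map)
qed

lemma pcas_successively:
  assumes "pcas u p v" and "set p \<subseteq> E"
  shows "successively (\<lambda>x y. (x, y) \<in> E) (u # map snd p) \<and> last (u # map snd p) = v"
  using assms
proof (induction p arbitrary: u)
  case (Cons e p)
  then show ?case by (cases e) (auto simp: successively_Cons)
qed simp

lemma successively_pcas:
  assumes "successively (\<lambda>x y. (x, y) \<in> E) (u # vs)"
  shows "pcas u (zip (u # vs) vs) (last (u # vs)) \<and> set (zip (u # vs) vs) \<subseteq> E"
  using assms
proof (induction vs arbitrary: u)
  case (Cons v vs)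
  then show ?case by auto
qed simp

lemma pawalk_verts_eq:
  assumes "pcas u p v"
  shows "pawalk_verts u p = u # map snd p"
  using assms by (induction p arbitrary: u) auto

text \<open>
  A closed walk corresponds to the list of the heads of its arcs: this list omits the start vertex,
  which occurs again as the last head, so it is distinct exactly for a cycle.
\<close>

lemma ugraph_forest_iff:
  assumes wf: "parcs H \<subseteq> pverts H \<times> pverts H"
  shows "ugraph_forest (with_proj H) \<longleftrightarrow> (\<nexists>xs. vcycle (parcs H) xs)"
proof -
  have "\<exists>xs. vcycle (parcs H) xs" if cyc: "ugraph_cycle (with_proj H) p" for p
  proof -
    from cyc obtain u where p: "3 \<le> length p" "set p \<subseteq> parcs H" "pcas u p u"
      and d: "distinct (tl (pawalk_verts u p))"
      by (auto simp: ugraph_cycle_def pre_digraph.cycle_def pre_digraph.awalk_def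
          cas_with_proj_eq awalk_verts_with_proj_eq)
    have "p \<noteq> []" using p(1) by auto
    have "vcycle (parcs H) (map snd p)"
      using pcas_successively[OF p(3,2)] d p(1) \<open>p \<noteq> []\<close>
      by (auto simp: vcycle_def pawalk_verts_eq[OF p(3)] successively_Cons)
    then show ?thesis by blast
  qed
  moreover have "\<exists>p. ugraph_cycle (with_proj H) p" if cyc: "vcycle (parcs H) xs" for xs
  proof -
    define u where "u = last xs"
    define p where "p = zip (u # xs) xs"
    have "xs \<noteq> []" using cyc by (auto simp: vcycle_def)
    then have "successively (\<lambda>x y. (x, y) \<in> parcs H) (u # xs)"
      using cyc by (auto simp: vcycle_def u_def successively_Cons)
    from successively_pcas[OF this] have p: "pcas u p u" "set p \<subseteq> parcs H"
      using \<open>xs \<noteq> []\<close> by (auto simp: p_def u_def)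
    have snds: "map snd p = xs" unfolding p_def by (rule nth_equalityI) auto
    have len: "length p = length xs" using snds by (metis length_map)
    have "u \<in> pverts H" using cyc wf by (auto simp: vcycle_def u_def)
    then have "ugraph_cycle (with_proj H) p"
      using p cyc \<open>xs \<noteq> []\<close> len
      by (auto simp: ugraph_cycle_def pre_digraph.cycle_def pre_digraph.awalk_def
          cas_with_proj_eq awalk_verts_with_proj_eq pawalk_verts_eq[OF p(1)] snds vcycle_def
          intro!: exI[of _ u])
    then show ?thesis by blast
  qed
  ultimately show ?thesis by (auto simp: ugraph_forest_def)
qed

lemma decycling_set_iff:
  "decycling_set G S \<longleftrightarrow> S \<subseteq> pverts G \<and> (\<nexists>xs. vcycle (Restr (parcs G) (pverts G - S)) xs)"
proof -
  let ?V = "pverts G - S"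
  let ?H = "\<lparr> pverts = ?V, parcs = Restr (parcs G) ?V \<rparr>"
  have "induce_subgraph (with_proj G) ?V = with_proj ?H"
    by (auto simp: induce_subgraph_def with_proj_def)
  then show ?thesis
    using ugraph_forest_iff[of ?H] by (simp add: decycling_set_def)
qed

section \<open>Matching and decycling numbers as extrema\<close>

lemma finite_card_matchings:
  assumes "finite (parcs G)"
  shows "finite {card M | M. is_matching G M}"
proof -
  have "uedges G = (\<lambda>(u, v). {u, v}) ` parcs G" by (auto simp: uedges_def)
  then have "finite (Pow (uedges G))" using assms by simp
  moreover have "{card M | M. is_matching G M} \<subseteq> card ` Pow (uedges G)"
    by (auto simp: is_matching_def)
  ultimately show ?thesis by (meson finite_imageI finite_subset)
qed

lemma matching_number_ge:
  assumes "finite (parcs G)" and "is_matching G M"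
  shows "card M \<le> matching_number G"
  unfolding matching_number_def using assms finite_card_matchings by (intro Max_ge) auto

lemma maximum_matching:
  assumes "finite (parcs G)"
  obtains M where "is_matching G M" "card M = matching_number G"
proof -
  have "is_matching G {}" by (simp add: is_matching_def)
  then have "matching_number G \<in> {card M | M. is_matching G M}"
    unfolding matching_number_def by (intro Max_in finite_card_matchings assms) auto
  then show thesis using that by auto
qed

lemma finite_card_decycling_sets:
  assumes "finite (pverts G)"
  shows "finite {card S | S. decycling_set G S}"
proof (rule finite_subset)
  show "{card S | S. decycling_set G S} \<subseteq> card ` Pow (pverts G)"
    by (auto simp: decycling_set_def)
qed (use assms in simp)

lemma decycling_number_le:
  assumes "finite (pverts G)" and "decycling_set G S"
  shows "decycling_number G \<le> card S"
  unfolding decycling_number_def using assms finite_card_decycling_sets by (intro Min_le) auto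

lemma minimum_decycling_set:
  assumes "finite (pverts G)"
  obtains S where "decycling_set G S" "card S = decycling_number G"
proof -
  have "decycling_set G (pverts G)" by (auto simp: decycling_set_iff vcycle_def)
  then have "decycling_number G \<in> {card S | S. decycling_set G S}"
    unfolding decycling_number_def by (intro Min_in finite_card_decycling_sets assms) auto
  then show thesis using that by auto
qed

section \<open>The lower bound\<close>

text \<open>Otherwise the four vertices of \<open>e \<times> f\<close> form a cycle that survives the deletion of \<open>S\<close>.\<close>

lemma decycling_set_meets_edge_product:
  assumes "pair_graph G" and "pair_graph H"
    and S: "decycling_set (cartesian_product G H) S"
    and "e \<in> uedges G" and "f \<in> uedges H"
  shows "S \<inter> e \<times> f \<noteq> {}"
proof
  interpret G: pair_graph G by fact
  interpret H: pair_graph H by fact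
  assume disj: "S \<inter> e \<times> f = {}"
  obtain a b where e: "e = {a, b}" and ab: "(a, b) \<in> parcs G"
    using \<open>e \<in> uedges G\<close> by (auto simp: uedges_def)
  obtain c d where f: "f = {c, d}" and cd: "(c, d) \<in> parcs H"
    using \<open>f \<in> uedges H\<close> by (auto simp: uedges_def)
  have rev: "(b, a) \<in> parcs G" "(d, c) \<in> parcs H"
    using ab cd G.pair_sym_arcs H.pair_sym_arcs by (auto simp: symmetric_def dest: symD)
  have ne: "a \<noteq> b" "c \<noteq> d" using G.pair_no_loops[OF ab] H.pair_no_loops[OF cd] by auto
  have verts: "a \<in> pverts G" "b \<in> pverts G" "c \<in> pverts H" "d \<in> pverts H"
    using ab cd G.wellformed' H.wellformed' by auto
  have "vcycle (Restr (parcs (cartesian_product G H)) (pverts (cartesian_product G H) - S))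
    [(a, c), (a, d), (b, d), (b, c)]"
    using ab cd rev ne verts disj by (auto simp: vcycle_def cartesian_product_def e f)
  with S show False by (auto simp: decycling_set_iff)
qed

lemma card_matchings_le_decycling_set:
  assumes "pair_graph G" and "pair_graph H"
    and M: "is_matching G M" and N: "is_matching H N"
    and S: "decycling_set (cartesian_product G H) S"
  shows "card M * card N \<le> card S"
proof -
  interpret P: pair_graph "cartesian_product G H"
    by (rule pair_graph_cartesian_product) fact+
  have "finite S"
    using S P.pair_finite_verts by (auto simp: decycling_set_def intro: finite_subset)
  have "\<forall>ef\<in>M \<times> N. \<exists>x. x \<in> S \<and> x \<in> fst ef \<times> snd ef"
    using decycling_set_meets_edge_product[OF assms(1,2) S] M N
    by (fastforce simp: is_matching_def)
  then obtain g where g: "\<And>e f. e \<in> M \<Longrightarrow> f \<in> N \<Longrightarrow> g (e, f) \<in> S \<and> g (e, f) \<in> e \<times> f"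
    using bchoice[of "M \<times> N" "\<lambda>ef x. x \<in> S \<and> x \<in> fst ef \<times> snd ef"] by auto
  have "inj_on g (M \<times> N)"
  proof (rule inj_onI, clarify)
    fix e f e' f' assume *: "e \<in> M" "f \<in> N" "e' \<in> M" "f' \<in> N" "g (e, f) = g (e', f')"
    then have "g (e, f) \<in> (e \<inter> e') \<times> (f \<inter> f')"
      using g[of e f] g[of e' f'] by auto
    then have ne: "e \<inter> e' \<noteq> {}" "f \<inter> f' \<noteq> {}" by auto
    have "e = e'" using ne(1) *(1,3) M unfolding is_matching_def by metis
    moreover have "f = f'" using ne(2) *(2,4) N unfolding is_matching_def by metis
    ultimately show "e = e' \<and> f = f'" ..
  qed
  moreover have "g ` (M \<times> N) \<subseteq> S" using g by auto
  ultimately have "card (M \<times> N) \<le> card S"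
    using \<open>finite S\<close> by (rule card_inj_on_le)
  then show ?thesis by (simp add: card_cartesian_product)
qed

lemma decycling_number_cartesian_product_ge:
  assumes "pair_graph G" and "pair_graph H"
  shows "matching_number G * matching_number H \<le> decycling_number (cartesian_product G H)"
proof -
  interpret G: pair_graph G by fact
  interpret H: pair_graph H by fact
  interpret P: pair_graph "cartesian_product G H"
    by (rule pair_graph_cartesian_product) fact+
  obtain M where M: "is_matching G M" "card M = matching_number G"
    using maximum_matching G.pair_finite_arcs by blast
  obtain N where N: "is_matching H N" "card N = matching_number H"
    using maximum_matching H.pair_finite_arcs by blast
  obtain S where S: "decycling_set (cartesian_product G H) S"
      "card S = decycling_number (cartesian_product G H)"
    using minimum_decycling_set P.pair_finite_verts by blast
  show ?thesis
    using card_matchings_le_decycling_set[OF assms M(1) N(1) S(1)] M(2) N(2) S(2) by simp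
qed

section \<open>Matchings and vertex covers of forests\<close>

text \<open>
  The first vertex of a longest path is a leaf: a further neighbour off the path would extend the
  path, and one on the path would close a cycle.
\<close>

lemma forest_has_leaf:
  assumes "finite E" and "sym E" and "irrefl E" and acyc: "\<nexists>xs. vcycle E xs" and "E \<noteq> {}"
  obtains u v where "(u, v) \<in> E" "\<And>w. (v, w) \<in> E \<Longrightarrow> w = u"
proof -
  let ?path = "\<lambda>xs. distinct xs \<and> successively (\<lambda>x y. (x, y) \<in> E) xs \<and> 2 \<le> length xs"
  have fin: "finite (Field E)" using \<open>finite E\<close> by (rule finite_Field)
  have sub: "set xs \<subseteq> Field E"
    if "successively (\<lambda>x y. (x, y) \<in> E) xs" "2 \<le> length xs" for xs
    using that
  proof (induction xs rule: induct_list012)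
    case (3 x y zs)
    then show ?case by (cases zs) (auto simp: Field_def)
  qed auto
  have bound: "length xs < Suc (card (Field E))" if "?path xs" for xs
    using that sub[of xs] card_mono[OF fin, of "set xs"] by (auto simp: distinct_card)
  obtain a b where ab: "(a, b) \<in> E" using \<open>E \<noteq> {}\<close> by auto
  then have "?path [a, b]" using \<open>irrefl E\<close> by (auto simp: irrefl_def)
  then obtain xs where xs: "?path xs" and max: "\<And>ys. ?path ys \<Longrightarrow> length ys \<le> length xs"
    using ex_has_greatest_nat[of ?path "[a, b]" length "Suc (card (Field E))"] bound by blast
  then obtain v u zs where vu: "xs = v # u # zs"
    by (cases xs rule: remdups_adj.cases) auto
  have "(v, u) \<in> E" using xs by (simp add: vu)
  show thesis
  proof (rule that)
    show "(u, v) \<in> E" using \<open>(v, u) \<in> E\<close> \<open>sym E\<close> by (rule symD[rotated])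
    fix w assume vw: "(v, w) \<in> E"
    then have wv: "(w, v) \<in> E" using \<open>sym E\<close> by (auto dest: symD)
    show "w = u"
    proof (rule ccontr)
      assume "w \<noteq> u"
      have "w \<noteq> v" using vw \<open>irrefl E\<close> by (auto simp: irrefl_def)
      show False
      proof (cases "w \<in> set zs")
        case False
        then have "?path (w # xs)"
          using xs wv \<open>w \<noteq> u\<close> \<open>w \<noteq> v\<close> by (auto simp: vu)
        from max[OF this] show False by simp
      next
        case True
        then obtain as bs where zs: "zs = as @ w # bs" by (auto dest: split_list)
        have "xs = (v # u # as @ [w]) @ bs" by (simp add: vu zs)
        with xs have "distinct (v # u # as @ [w])"
          and "successively (\<lambda>x y. (x, y) \<in> E) (v # u # as @ [w])"
          by (auto simp only: distinct_append successively_append_iff)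
        then have "vcycle E (v # u # as @ [w])" using wv by (simp add: vcycle_def)
        with acyc show False by blast
      qed
    qed
  qed
qed

text \<open>
  If \<open>v\<close> is a leaf with neighbour \<open>u\<close>, put \<open>u\<close> into the cover and \<open>uv\<close> into the matching, and
  continue with the edges that avoid \<open>u\<close>. These also avoid \<open>v\<close>, so the matching stays one.
\<close>

lemma forest_matching_vertex_cover:
  assumes "finite E" and "sym E" and "irrefl E" and "\<nexists>xs. vcycle E xs"
  obtains M C where
    "M \<subseteq> {{u, v} | u v. (u, v) \<in> E}" "\<forall>e\<in>M. \<forall>f\<in>M. e \<noteq> f \<longrightarrow> e \<inter> f = {}"
    "C \<subseteq> Field E" "\<forall>u v. (u, v) \<in> E \<longrightarrow> u \<in> C \<or> v \<in> C" "card C = card M"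
proof -
  have "\<exists>M C. finite M \<and> finite C \<and> M \<subseteq> {{u, v} | u v. (u, v) \<in> E} \<and>
      (\<forall>e\<in>M. \<forall>f\<in>M. e \<noteq> f \<longrightarrow> e \<inter> f = {}) \<and> C \<subseteq> Field E \<and>
      (\<forall>u v. (u, v) \<in> E \<longrightarrow> u \<in> C \<or> v \<in> C) \<and> card C = card M"
    using assms
  proof (induction "card E" arbitrary: E rule: less_induct)
    case less
    show ?case
    proof (cases "E = {}")
      case True
      then show ?thesis by (intro exI[of _ "{}"]) auto
    next
      case False
      from forest_has_leaf[OF less.prems this]
      obtain u v where uv: "(u, v) \<in> E" and leaf: "\<And>w. (v, w) \<in> E \<Longrightarrow> w = u" by blast
      define F where "F = {(a, b) \<in> E. a \<noteq> u \<and> b \<noteq> u}"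
      have "F \<subseteq> E" by (auto simp: F_def)
      have "F \<subset> E" using uv by (auto simp: F_def)
      have avoid: "a \<notin> {u, v} \<and> b \<notin> {u, v}" if "(a, b) \<in> F" for a b
        using that leaf less.prems(2) by (auto simp: F_def dest: symD)
      have card: "card F < card E" using \<open>F \<subset> E\<close> less.prems(1) by (rule psubset_card_mono[rotated])
      have fin: "finite F" using \<open>F \<subseteq> E\<close> less.prems(1) by (rule finite_subset)
      have sym: "sym F" using less.prems(2) by (auto simp: F_def sym_def)
      have irr: "irrefl F" using less.prems(3) by (auto simp: F_def irrefl_def)
      have acyc: "\<nexists>xs. vcycle F xs" using less.prems(4) vcycle_mono \<open>F \<subseteq> E\<close> by blast
      obtain M C where IH: "finite M" "finite C" "M \<subseteq> {{a, b} | a b. (a, b) \<in> F}"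
        "\<forall>e\<in>M. \<forall>f\<in>M. e \<noteq> f \<longrightarrow> e \<inter> f = {}" "C \<subseteq> Field F"
        "\<forall>a b. (a, b) \<in> F \<longrightarrow> a \<in> C \<or> b \<in> C" "card C = card M"
        using less.hyps[OF card fin sym irr acyc] by (elim exE conjE) (rule that)
      have disj: "e \<inter> {u, v} = {}" if "e \<in> M" for e
        using that IH(3) avoid by fastforce
      have "{u, v} \<notin> M" using disj by blast
      have "u \<notin> C" using IH(5) avoid by (fastforce simp: Field_def)
      have "insert {u, v} M \<subseteq> {{a, b} | a b. (a, b) \<in> E}"
        using IH(3) uv \<open>F \<subseteq> E\<close> by blast
      moreover have "\<forall>e\<in>insert {u, v} M. \<forall>f\<in>insert {u, v} M. e \<noteq> f \<longrightarrow> e \<inter> f = {}"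
        using disj IH(4) by (metis Int_commute insert_iff)
      moreover have "insert u C \<subseteq> Field E"
        using IH(5) mono_Field[OF \<open>F \<subseteq> E\<close>] FieldI1[OF uv] by blast
      moreover have "\<forall>a b. (a, b) \<in> E \<longrightarrow> a \<in> insert u C \<or> b \<in> insert u C"
        using IH(6) unfolding F_def by blast
      moreover have "card (insert u C) = card (insert {u, v} M)"
        using IH(1,2,7) \<open>{u, v} \<notin> M\<close> \<open>u \<notin> C\<close> by simp
      ultimately show ?thesis
        using IH(1,2) by (intro exI[of _ "insert {u, v} M"] exI[of _ "insert u C"]) simp
    qed
  qed
  then show thesis by (elim exE conjE) (rule that)
qed

section \<open>The prism over a forest\<close>

text \<open>
  A vertex \<open>(v, 0)\<close> with \<open>v \<notin> C\<close> keeps only its neighbour \<open>(v, 1)\<close>, because \<open>C\<close> covers all edges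
  at \<open>v\<close>. A surviving cycle would therefore lie in the layer 1 and project to a cycle of \<open>G\<close>.
\<close>

lemma vertex_cover_decycles_prism:
  assumes "pair_graph G" and forest: "ugraph_forest (with_proj G)"
    and C: "C \<subseteq> pverts G" and cover: "\<And>u v. (u, v) \<in> parcs G \<Longrightarrow> u \<in> C \<or> v \<in> C"
  shows "decycling_set (cartesian_product G (path_graph 2)) (C \<times> {0})"
proof -
  interpret G: pair_graph G by fact
  let ?P = "cartesian_product G (path_graph 2)"
  let ?S = "C \<times> {0::nat}"
  let ?R = "Restr (parcs ?P) (pverts ?P - ?S)"
  interpret P: pair_graph ?P
    by (intro pair_graph_cartesian_product pair_graph_path_graph) fact
  have wf: "parcs G \<subseteq> pverts G \<times> pverts G" using G.wellformed' by auto
  have "sym (parcs ?P)" using P.pair_sym_arcs by (simp add: symmetric_def)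
  then have symR: "sym ?R" by (auto simp: sym_def)
  have False if cyc: "vcycle ?R xs" for xs
  proof -
    have layer: "snd x = 1" if "x \<in> set xs" for x
    proof (rule ccontr)
      assume "snd x \<noteq> 1"
      obtain y z where "y \<noteq> z" and yz: "(x, y) \<in> ?R" "(x, z) \<in> ?R"
        using vcycle_two_neighbours[OF cyc symR \<open>x \<in> set xs\<close>] .
      have "w = (fst x, 1)" if "(x, w) \<in> ?R" for w
        using that \<open>snd x \<noteq> 1\<close> cover
        by (fastforce simp: cartesian_product_def path_graph_def)
      with yz \<open>y \<noteq> z\<close> show False by blast
    qed
    have "vcycle (parcs G) (map fst xs)"
    proof (rule vcycle_map[OF cyc])
      show "inj_on fst (set xs)" using layer by (auto simp: inj_on_def prod_eq_iff)
      show "(fst x, fst y) \<in> parcs G" if "x \<in> set xs" "y \<in> set xs" "(x, y) \<in> ?R" for x y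
        using that layer[of x] layer[of y]
        by (auto simp: cartesian_product_def path_graph_def)
    qed
    with forest show False by (auto simp: ugraph_forest_iff[OF wf])
  qed
  moreover have "?S \<subseteq> pverts ?P"
    using C by (auto simp: cartesian_product_def path_graph_def)
  ultimately show ?thesis by (auto simp: decycling_set_iff)
qed

lemma matching_number_path_graph_2: "1 \<le> matching_number (path_graph 2)"
proof -
  interpret P: pair_graph "path_graph 2" by (rule pair_graph_path_graph)
  have "(0, 1) \<in> parcs (path_graph 2)" by (auto simp: path_graph_def)
  then have "is_matching (path_graph 2) {{0, 1}}"
    by (auto simp: is_matching_def uedges_def)
  from matching_number_ge[OF P.pair_finite_arcs this] show ?thesis by simp
qed

lemma decycling_number_forest_prism:
  assumes "pair_graph G" and forest: "ugraph_forest (with_proj G)"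
  shows "decycling_number (cartesian_product G (path_graph 2)) = matching_number G"
proof (rule antisym)
  interpret G: pair_graph G by fact
  interpret P: pair_graph "cartesian_product G (path_graph 2)"
    by (intro pair_graph_cartesian_product pair_graph_path_graph) fact
  have wf: "parcs G \<subseteq> pverts G \<times> pverts G" using G.wellformed' by auto
  have sym: "sym (parcs G)" using G.pair_sym_arcs by (simp add: symmetric_def)
  have irr: "irrefl (parcs G)" by (auto simp: irrefl_def dest: G.pair_no_loops)
  have acyc: "\<nexists>xs. vcycle (parcs G) xs"
    using forest by (simp add: ugraph_forest_iff[OF wf])
  obtain M C where M: "M \<subseteq> uedges G"
      "\<forall>e\<in>M. \<forall>f\<in>M. e \<noteq> f \<longrightarrow> e \<inter> f = {}"
    and C: "C \<subseteq> Field (parcs G)" "\<forall>u v. (u, v) \<in> parcs G \<longrightarrow> u \<in> C \<or> v \<in> C"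
    and card: "card C = card M"
    using forest_matching_vertex_cover[OF G.pair_finite_arcs sym irr acyc, folded uedges_def] .
  have "is_matching G M" using M unfolding is_matching_def by blast
  have "C \<subseteq> pverts G" using C(1) wf by (auto simp: Field_def)
  have "decycling_number (cartesian_product G (path_graph 2)) \<le> card (C \<times> {0::nat})"
    using C(2) by (intro decycling_number_le P.pair_finite_verts
        vertex_cover_decycles_prism[OF assms \<open>C \<subseteq> pverts G\<close>]) simp
  also have "\<dots> = card M" by (simp add: card_cartesian_product card)
  also have "\<dots> \<le> matching_number G"
    using G.pair_finite_arcs \<open>is_matching G M\<close> by (rule matching_number_ge)
  finally show "decycling_number (cartesian_product G (path_graph 2)) \<le> matching_number G" .
next
  have "matching_number G * 1 \<le> matching_number G * matching_number (path_graph 2)"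
    using matching_number_path_graph_2 by (rule mult_le_mono2)
  also have "\<dots> \<le> decycling_number (cartesian_product G (path_graph 2))"
    using assms(1) pair_graph_path_graph by (rule decycling_number_cartesian_product_ge)
  finally show "matching_number G \<le> decycling_number (cartesian_product G (path_graph 2))" by simp
qed

theorem theorem4p3:
  shows "(\<forall>(G1 :: 'a pair_pre_digraph) (G2 :: 'b pair_pre_digraph).
            pair_graph G1 \<longrightarrow> pair_graph G2 \<longrightarrow>
            decycling_number (cartesian_product G1 G2) \<ge> matching_number G1 * matching_number G2)
       \<and> (\<forall>T :: 'c pair_pre_digraph.
            pair_graph T \<longrightarrow> ugraph_tree (with_proj T) \<longrightarrow>
            decycling_number (cartesian_product T (path_graph 2)) = matching_number T)"
  using decycling_number_cartesian_product_ge decycling_number_forest_prism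
  unfolding ugraph_tree_def by blast

end
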